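(* Let $n\ge1$. For every integer $r$ with $1\le r\le n$, the probability $p_{r,n}$ admits the integral representation $$p_{r,n}=\int_0^\infty r e^{-rt}\prod_{\substack{1\le k\le n\\ k\ne r}}\bigl(1-e^{-kt}\bigr)\,dt .$$ Equivalently, $$p_{r,n}=\int_0^1 r\,u^{r-1}\prod_{\substack{1\le k\le n\\ k\ne r}}(1-u^k)\,du .$$
   Context: For $n\ge 1$, let $X_1,\ldots,X_n$ be independent standard exponential (rate $1$) random variables with order statistics $X_{1:n}\le\cdots\le X_{n:n}$, and put $X_{0:n}:=0$. The spacings are $S_{j,n}:=X_{j:n}-X_{j-1:n}$, $j=1,\ldots,n$. Let $I_n:=\arg\max_{1\le j\le n}S_{j,n}$ be the (almost surely unique) index of the largest spacing, let $R_n:=n-I_n+1$, and put $p_{r,n}:=\mathbb P(R_n=r)$ for $1\le r\le n$. Writing $Y_r:=S_{n-r+1,n}$ for $1\le r\le n$, Sukhatme's classical representation states that $Y_1,\ldots,Y_n$ are independent and $Y_r$ has the exponential distribution with rate $r$ (density $re^{-rt}$, $t>0$); thus $p_{r,n}=\mathbb P\left(Y_r=\max_{1\le k\le n}Y_k\right)$. Empty products are equal to $1$. *)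

theory Defs
  imports "HOL-Probability.Probability"
begin

definition order_stat :: "(nat \<Rightarrow> 'a \<Rightarrow> real) \<Rightarrow> nat \<Rightarrow> nat \<Rightarrow> 'a \<Rightarrow> real" where
  "order_stat X n j \<omega> =
     (if j = 0 then 0 else sort (map (\<lambda>i. X i \<omega>) [1..<Suc n]) ! (j - 1))"

definition spacing :: "(nat \<Rightarrow> 'a \<Rightarrow> real) \<Rightarrow> nat \<Rightarrow> nat \<Rightarrow> 'a \<Rightarrow> real" where
  "spacing X n j \<omega> = order_stat X n j \<omega> - order_stat X n (j - 1) \<omega>"

(* arg_max_on breaks ties by a choice that depends only on the set of maximising
   indices; for independent continuous samples ties occur with probability 0. *)
definition max_spacing_index :: "(nat \<Rightarrow> 'a \<Rightarrow> real) \<Rightarrow> nat \<Rightarrow> 'a \<Rightarrow> nat" where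
  "max_spacing_index X n \<omega> = arg_max_on (\<lambda>j. spacing X n j \<omega>) {1..n}"

definition max_spacing_rank :: "(nat \<Rightarrow> 'a \<Rightarrow> real) \<Rightarrow> nat \<Rightarrow> 'a \<Rightarrow> nat" where
  "max_spacing_rank X n \<omega> = n - max_spacing_index X n \<omega> + 1"

definition rank_prob :: "'a measure \<Rightarrow> (nat \<Rightarrow> 'a \<Rightarrow> real) \<Rightarrow> nat \<Rightarrow> nat \<Rightarrow> real" where
  "rank_prob M X n r = measure M {\<omega> \<in> space M. max_spacing_rank X n \<omega> = r}"

end

theory Submission
  imports Defs
begin

text \<open>
  Sukhatme's representation is proved by removing the minimum. On the event that \<open>X i\<close> is the
  smallest of \<open>n\<close> standard exponentials, memorylessness makes the remaining variables, shifted by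
  \<open>X i\<close>, again independent standard exponentials, with a factor \<open>exp (- (n - 1) * X i)\<close>; the sum
  over \<open>i\<close> turns the law of the first spacing into the exponential law of rate \<open>n\<close>, and the other
  spacings are those of \<open>n - 1\<close> exponentials. The event that spacing \<open>Y r\<close> is selected lies
  between \<open>\<forall>k \<noteq> r. Y k < Y r\<close> and \<open>\<forall>k. Y k \<le> Y r\<close>. By Fubini, conditioning on \<open>Y r = t\<close>,
  both have the integral of \<open>r * exp (- r * t)\<close> times the product of \<open>1 - exp (- k * t)\<close> as their
  probability, so ties need no separate treatment. The second form is the substitution
  \<open>u = exp (- t)\<close>.
\<close>


section \<open>Exponential laws and memorylessness under a common shift\<close>

abbreviation exp_measure :: "real \<Rightarrow> real measure" where
  "exp_measure l \<equiv> density lborel (\<lambda>x. ennreal (exponential_density l x))"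

lemma prob_space_exp_measure: "0 < l \<Longrightarrow> prob_space (exp_measure l)"
  using prob_space_exponential_density .

lemma product_sigma_finite_exp_measure:
  assumes "\<And>i. 0 \<le> l i"
  shows "product_sigma_finite (\<lambda>i. exp_measure (l i))"
proof (rule product_sigma_finite.intro)
  fix i
  show "sigma_finite_measure (exp_measure (l i))"
  proof (cases "l i = 0")
    case True
    have "exponential_density 0 = (\<lambda>_. 0)"
      by (auto simp: fun_eq_iff exponential_density_def)
    then have "emeasure (exp_measure (l i)) UNIV = 0"
      using True by (subst emeasure_density) auto
    then show ?thesis
      by (intro finite_measure.axioms(1) finite_measureI) simp
  next
    case False
    then show ?thesis using assms[of i] by (intro prob_space_imp_sigma_finite prob_space_exp_measure) simp
  qed
qed

text \<open>The density of rate 1 at \<open>t + z\<close> is \<open>exp (- t)\<close> times the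
  density at \<open>z\<close>. Only the endpoint \<open>t\<close> may or may not belong to
  \<open>U\<close>, and a single point is null; both kinds of ray occur once ties are broken by
  index.\<close>

lemma exp_measure_memoryless:
  assumes t: "0 \<le> t" and U: "{t<..} \<subseteq> U" "U \<subseteq> {t..}"
    and [measurable]: "U \<in> sets borel" "h \<in> borel_measurable borel"
  shows "(\<integral>\<^sup>+ y. indicator U y * h (y - t) \<partial>exp_measure 1) = ennreal (exp (- t)) * (\<integral>\<^sup>+ y. h y \<partial>exp_measure 1)"
proof -
  have "(\<integral>\<^sup>+ y. indicator U y * h (y - t) \<partial>exp_measure 1)
      = (\<integral>\<^sup>+ y. ennreal (exponential_density 1 y) * (indicator U y * h (y - t)) \<partial>lborel)"
    by (subst nn_integral_density) auto
  also have "\<dots> = (\<integral>\<^sup>+ z. ennreal (exponential_density 1 (t + z)) * (indicator U (t + z) * h z) \<partial>lborel)"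
    by (subst nn_integral_real_affine[where c = 1 and t = t]) auto
  also have "\<dots> = (\<integral>\<^sup>+ z. ennreal (exp (- t)) * (ennreal (exponential_density 1 z) * h z) \<partial>lborel)"
  proof (rule nn_integral_cong_AE)
    show "AE z in lborel. ennreal (exponential_density 1 (t + z)) * (indicator U (t + z) * h z)
        = ennreal (exp (- t)) * (ennreal (exponential_density 1 z) * h z)"
      \<comment> \<open>At \<open>z = 0\<close> the argument \<open>t + z\<close> is the endpoint,
        the one point whose membership in \<open>U\<close> is left open.\<close>
      using AE_lborel_singleton[of 0]
    proof eventually_elim
      case (elim z)
      show ?case
      proof (cases "z < 0")
        case True
        then have "t + z \<notin> U" using U by auto
        then show ?thesis using True by (simp add: exponential_density_def)
      next
        case False
        then have "t + z \<in> U" using U elim by auto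
        moreover have "ennreal (exp (- (t + z))) = ennreal (exp (- t)) * ennreal (exp (- z))"
          by (simp add: ennreal_mult'[symmetric] exp_add[symmetric])
        ultimately show ?thesis using False t
          by (simp add: exponential_density_def mult.assoc)
      qed
    qed
  qed
  also have "\<dots> = ennreal (exp (- t)) * (\<integral>\<^sup>+ y. h y \<partial>exp_measure 1)"
    by (simp add: nn_integral_cmult nn_integral_density)
  finally show ?thesis .
qed

text \<open>Induction on \<open>J\<close>: one coordinate is split off by Fubini and handled by the
  one-dimensional case, so each coordinate contributes one factor \<open>exp (- t)\<close>. The ray
  may vary with \<open>k\<close> to fit the tie-breaking below.\<close>

lemma PiM_exp_measure_memoryless:
  assumes "finite J" "0 \<le> t"
    and "\<And>k. k \<in> J \<Longrightarrow> {t<..} \<subseteq> U k \<and> U k \<subseteq> {t..} \<and> U k \<in> sets borel"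
    and "H \<in> borel_measurable (PiM J (\<lambda>_. borel))"
  shows "(\<integral>\<^sup>+ x. (\<Prod>k\<in>J. indicator (U k) (x k)) * H (\<lambda>k\<in>J. x k - t) \<partial>PiM J (\<lambda>_. exp_measure 1))
    = ennreal (exp (- t)) ^ card J * (\<integral>\<^sup>+ x. H x \<partial>PiM J (\<lambda>_. exp_measure 1))"
  using assms
proof (induction J arbitrary: H rule: finite_induct)
  case empty
  interpret product_sigma_finite "\<lambda>_::'a. exp_measure 1" by (rule product_sigma_finite_exp_measure) simp
  show ?case by (simp add: PiM_empty nn_integral_count_space_finite restrict_def)
next
  case (insert i J)
  interpret product_sigma_finite "\<lambda>_::'a. exp_measure 1" by (rule product_sigma_finite_exp_measure) simp
  have sJ: "sets (PiM K (\<lambda>_. exp_measure 1)) = sets (PiM K (\<lambda>_. borel))" for K :: "'a set"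
    by (intro sets_PiM_cong) auto
  have [measurable]: "H \<in> borel_measurable (PiM (insert i J) (\<lambda>_. borel))" by (rule insert.prems)
  have [measurable]: "U k \<in> sets borel" if "k \<in> insert i J" for k using insert.prems that by auto
  have Hm: "H \<in> borel_measurable (PiM (insert i J) (\<lambda>_. exp_measure 1))"
    using insert.prems sJ[of "insert i J"] by (simp cong: measurable_cong_sets)
  have m1: "(\<lambda>x. (\<Prod>k\<in>insert i J. indicator (U k) (x k)) * H (\<lambda>k\<in>insert i J. x k - t))
      \<in> borel_measurable (PiM (insert i J) (\<lambda>_. borel))"
    by measurable
  have upd: "(\<lambda>x. H (x(i := y))) \<in> borel_measurable (PiM J (\<lambda>_. borel))" for y
    by measurable
  have "(\<lambda>p. H ((snd p)(i := fst p))) \<in> borel_measurable (borel \<Otimes>\<^sub>M PiM J (\<lambda>_. borel))"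
    by measurable
  then have [measurable]: "(\<lambda>p. H ((snd p)(i := fst p))) \<in> borel_measurable (borel \<Otimes>\<^sub>M PiM J (\<lambda>_. exp_measure 1))"
    by (simp add: sJ cong: measurable_cong_sets sets_pair_measure_cong)
  interpret PJ: sigma_finite_measure "PiM J (\<lambda>_. exp_measure 1)" by (rule sigma_finite) (fact insert.hyps)
  have inner: "(\<lambda>w. \<integral>\<^sup>+ x. H (x(i := w)) \<partial>PiM J (\<lambda>_. exp_measure 1)) \<in> borel_measurable borel"
    by (rule PJ.borel_measurable_nn_integral) (simp add: split_beta')
  have "(\<integral>\<^sup>+ x. (\<Prod>k\<in>insert i J. indicator (U k) (x k)) * H (\<lambda>k\<in>insert i J. x k - t)
         \<partial>PiM (insert i J) (\<lambda>_. exp_measure 1))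
    = (\<integral>\<^sup>+ y. (\<integral>\<^sup>+ x. (\<Prod>k\<in>insert i J. indicator (U k) ((x(i := y)) k))
         * H (\<lambda>k\<in>insert i J. (x(i := y)) k - t) \<partial>PiM J (\<lambda>_. exp_measure 1)) \<partial>exp_measure 1)"
    using m1 sJ[of "insert i J"] insert.hyps
    by (intro product_nn_integral_insert_rev) (simp_all cong: measurable_cong_sets)
  also have "\<dots> = (\<integral>\<^sup>+ y. (\<integral>\<^sup>+ x. indicator (U i) y * ((\<Prod>k\<in>J. indicator (U k) (x k))
         * (\<lambda>z. H (z(i := y - t))) (\<lambda>k\<in>J. x k - t)) \<partial>PiM J (\<lambda>_. exp_measure 1)) \<partial>exp_measure 1)"
  proof (intro nn_integral_cong)
    fix y x
    have "(\<Prod>k\<in>J. indicator (U k) ((x(i := y)) k)) = (\<Prod>k\<in>J. indicator (U k) (x k) :: ennreal)"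
      using insert.hyps by (intro prod.cong) auto
    moreover have "(\<lambda>k\<in>insert i J. (x(i := y)) k - t) = (\<lambda>k\<in>J. x k - t)(i := y - t)"
      using insert.hyps by (auto simp: fun_eq_iff)
    ultimately show "(\<Prod>k\<in>insert i J. indicator (U k) ((x(i := y)) k)) * H (\<lambda>k\<in>insert i J. (x(i := y)) k - t)
      = indicator (U i) y * ((\<Prod>k\<in>J. indicator (U k) (x k)) * (\<lambda>z. H (z(i := y - t))) (\<lambda>k\<in>J. x k - t))"
      using insert.hyps by (simp add: mult.assoc)
  qed
  \<comment> \<open>For fixed \<open>y\<close> the induction hypothesis is applied to
    \<open>\<lambda>z. H (z(i := y - t))\<close>.\<close>
  also have "\<dots> = (\<integral>\<^sup>+ y. indicator (U i) y * (ennreal (exp (- t)) ^ card J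
         * (\<integral>\<^sup>+ x. H (x(i := y - t)) \<partial>PiM J (\<lambda>_. exp_measure 1))) \<partial>exp_measure 1)"
  proof (intro nn_integral_cong)
    fix y
    have m2: "(\<lambda>x. (\<Prod>k\<in>J. indicator (U k) (x k)) * H ((\<lambda>k\<in>J. x k - t)(i := y - t)))
      \<in> borel_measurable (PiM J (\<lambda>_. borel))"
      by measurable
    show "(\<integral>\<^sup>+ x. indicator (U i) y * ((\<Prod>k\<in>J. indicator (U k) (x k))
         * (\<lambda>z. H (z(i := y - t))) (\<lambda>k\<in>J. x k - t)) \<partial>PiM J (\<lambda>_. exp_measure 1))
      = indicator (U i) y * (ennreal (exp (- t)) ^ card J
         * (\<integral>\<^sup>+ x. H (x(i := y - t)) \<partial>PiM J (\<lambda>_. exp_measure 1)))"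
      using m2 sJ[of J] insert.prems upd
      by (subst nn_integral_cmult, simp cong: measurable_cong_sets) (subst insert.IH, auto)
  qed
  also have "\<dots> = ennreal (exp (- t)) ^ card J * (\<integral>\<^sup>+ y. indicator (U i) y
         * (\<integral>\<^sup>+ x. H (x(i := y - t)) \<partial>PiM J (\<lambda>_. exp_measure 1)) \<partial>exp_measure 1)"
    using inner by (subst nn_integral_cmult[symmetric]) (auto simp: mult_ac)
  also have "\<dots> = ennreal (exp (- t)) ^ card (insert i J) *
      (\<integral>\<^sup>+ y. (\<integral>\<^sup>+ x. H (x(i := y)) \<partial>PiM J (\<lambda>_. exp_measure 1)) \<partial>exp_measure 1)"
    using insert.prems insert.hyps inner
    by (subst exp_measure_memoryless[where h = "\<lambda>y. \<integral>\<^sup>+ x. H (x(i := y)) \<partial>PiM J (\<lambda>_. exp_measure 1)"]) (auto simp: mult_ac)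
  also have "(\<integral>\<^sup>+ y. (\<integral>\<^sup>+ x. H (x(i := y)) \<partial>PiM J (\<lambda>_. exp_measure 1)) \<partial>exp_measure 1)
      = (\<integral>\<^sup>+ x. H x \<partial>PiM (insert i J) (\<lambda>_. exp_measure 1))"
    using insert.hyps Hm by (intro product_nn_integral_insert_rev[symmetric]) auto
  finally show ?case .
qed

section \<open>Gaps of sorted lists and measurability of order statistics\<close>

text \<open>Zero-based: \<open>gap\<close> at \<open>j\<close> corresponds to the spacing with index \<open>j + 1\<close>.\<close>

definition gap :: "real list \<Rightarrow> nat \<Rightarrow> real" where
  "gap xs j = xs ! j - (if j = 0 then 0 else xs ! (j - 1))"

lemma gap_Cons_0 [simp]: "gap (a # xs) 0 = a"
  by (simp add: gap_def)

text \<open>For \<open>j = 0\<close> the shift cancels against the prepended entry \<open>a\<close>;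
  for larger \<open>j\<close> it cancels in the difference of two shifted entries.\<close>

lemma gap_Cons_Suc: "j < length xs \<Longrightarrow> gap (a # map (\<lambda>y. y + a) xs) (Suc j) = gap xs j"
  by (cases j) (auto simp: gap_def)

text \<open>Passing to excesses over the minimum is a monotone shift, so sorting the excesses and
  shifting back sorts the original values. The later gaps thus become those of the smaller sample of
  excesses.\<close>

lemma sort_insert_min:
  fixes x :: "'i::linorder \<Rightarrow> real"
  assumes "finite J" "i \<notin> J" "\<And>k. k \<in> J \<Longrightarrow> x i \<le> x k"
  shows "sort (map x (sorted_list_of_set (insert i J)))
    = x i # map (\<lambda>y. y + x i) (sort (map (\<lambda>k. x k - x i) (sorted_list_of_set J)))" (is "_ = ?r")
proof (rule properties_for_sort)
  show "mset ?r = mset (map x (sorted_list_of_set (insert i J)))"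
    using assms by (simp add: image_mset.compositionality o_def)
  show "sorted ?r"
    using assms by (auto simp: sorted_map intro!: sorted_wrt_mono_rel[OF _ sorted_sort])
qed

text \<open>In a sorted list the entries at most \<open>a\<close> form an initial segment. Events
  about an order statistic thereby become events about a count.\<close>

lemma sorted_nth_le_iff:
  fixes xs :: "'a::linorder list"
  assumes "sorted xs" "j < length xs"
  shows "xs ! j \<le> a \<longleftrightarrow> j < length (filter (\<lambda>y. y \<le> a) xs)"
  using assms
proof (induction xs arbitrary: j)
  case (Cons x xs)
  show ?case
  proof (cases "x \<le> a")
    case True
    then show ?thesis using Cons by (cases j) auto
  next
    case False
    then have "filter (\<lambda>y. y \<le> a) (x # xs) = []" using Cons.prems by (auto simp: filter_empty_conv)
    moreover have "x \<le> (x # xs) ! j" using Cons.prems by (cases j) auto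
    ultimately show ?thesis using False by auto
  qed
qed simp

text \<open>Entry \<open>j\<close> is at most \<open>a\<close> exactly when more than
  \<open>j\<close> of the variables are, and this count is measurable by adding one variable at a
  time.\<close>

lemma borel_measurable_sort_nth:
  fixes X :: "'i \<Rightarrow> 'a \<Rightarrow> real"
  assumes "\<And>i. i \<in> set is \<Longrightarrow> X i \<in> borel_measurable N" "j < length is"
  shows "(\<lambda>\<omega>. sort (map (\<lambda>i. X i \<omega>) is) ! j) \<in> borel_measurable N"
proof (rule borel_measurableI_le)
  fix a
  \<comment> \<open>Sorting does not change how many entries are at most \<open>a\<close>.\<close>
  have len: "length (filter (\<lambda>y. y \<le> a) (sort xs)) = length (filter (\<lambda>y. y \<le> a) xs)" for xs :: "real list"
    by (simp add: filter_sort)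
  have cnt: "(\<lambda>\<omega>. length (filter (\<lambda>y. y \<le> a) (map (\<lambda>i. X i \<omega>) js))) \<in> measurable N (count_space UNIV)"
    if "set js \<subseteq> set is" for js
    using that
  proof (induction js)
    case (Cons i js)
    then have [measurable]: "X i \<in> borel_measurable N" using assms by auto
    have [measurable]: "(\<lambda>\<omega>. length (filter (\<lambda>y. y \<le> a) (map (\<lambda>i. X i \<omega>) js))) \<in> measurable N (count_space UNIV)"
      using Cons by auto
    have "(\<lambda>\<omega>. if X i \<omega> \<le> a then Suc (length (filter (\<lambda>y. y \<le> a) (map (\<lambda>i. X i \<omega>) js)))
        else length (filter (\<lambda>y. y \<le> a) (map (\<lambda>i. X i \<omega>) js))) \<in> measurable N (count_space UNIV)"
      by measurable
    then show ?case by (simp add: if_distrib[where f = length] cong: if_cong)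
  qed simp
  note [measurable] = cnt[OF order_refl]
  have "{\<omega> \<in> space N. sort (map (\<lambda>i. X i \<omega>) is) ! j \<le> a}
    = {\<omega> \<in> space N. j < length (filter (\<lambda>y. y \<le> a) (map (\<lambda>i. X i \<omega>) is))}"
    using assms(2) by (subst sorted_nth_le_iff) (auto simp: len simp del: filter_map)
  also have "\<dots> \<in> sets N" by measurable
  finally show "{\<omega> \<in> space N. sort (map (\<lambda>i. X i \<omega>) is) ! j \<le> a} \<in> sets N" .
qed

lemma borel_measurable_gap_sort:
  fixes X :: "'i \<Rightarrow> 'a \<Rightarrow> real"
  assumes "\<And>i. i \<in> set is \<Longrightarrow> X i \<in> borel_measurable N" "j < length is"
  shows "(\<lambda>\<omega>. gap (sort (map (\<lambda>i. X i \<omega>) is)) j) \<in> borel_measurable N"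
  using assms unfolding gap_def
  by (cases "j = 0") (auto intro!: borel_measurable_diff borel_measurable_sort_nth)


section \<open>Removing the minimum and the joint law of the gaps\<close>

text \<open>
  Breaking ties in favour of the least index makes the events that \<open>x i\<close> is the minimum an exact
  partition; this is why the rays \<open>U k\<close> above may be open or closed.
\<close>

lemma sum_min_indicator:
  fixes x :: "'i::linorder \<Rightarrow> real"
  assumes "finite I" "I \<noteq> {}"
  shows "(\<Sum>i\<in>I. \<Prod>k\<in>I - {i}. indicator (if k < i then {x i<..} else {x i..}) (x k)) = (1 :: ennreal)"
proof -
  define m where "m = Min (x ` I)"
  define i0 where "i0 = Min {i \<in> I. x i = m}"
  have "m \<in> x ` I" using assms unfolding m_def by (intro Min_in) auto
  then have ne: "{i \<in> I. x i = m} \<noteq> {}" by auto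
  have i0: "i0 \<in> I" "x i0 = m"
    using Min_in[OF _ ne] assms(1) unfolding i0_def by auto
  have le: "m \<le> x k" if "k \<in> I" for k using that assms unfolding m_def by simp
  have least: "i0 \<le> k" if "k \<in> I" "x k = m" for k
    using that assms unfolding i0_def by (intro Min_le) auto
  have "(\<Prod>k\<in>I - {i}. indicator (if k < i then {x i<..} else {x i..}) (x k)) = (if i = i0 then 1 else 0 :: ennreal)"
    if i: "i \<in> I" for i
  proof (cases "i = i0")
    case True
    have "(\<Prod>k\<in>I - {i}. indicator (if k < i then {x i<..} else {x i..}) (x k)) = (1 :: ennreal)"
    proof (intro prod.neutral ballI)
      fix k assume "k \<in> I - {i}"
      then show "indicator (if k < i then {x i<..} else {x i..}) (x k) = (1 :: ennreal)"
        using True le[of k] least[of k] i0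
        by (cases "x k = x i0") (auto simp: indicator_def order.not_eq_order_implies_strict)
    qed
    then show ?thesis using True by simp
  next
    case False
    \<comment> \<open>If \<open>i0 < i\<close>, the open ray would require
      \<open>x i < x i0\<close>, against minimality. If \<open>i < i0\<close>, the closed ray would
      require \<open>x i \<le> x i0\<close>, making \<open>i\<close> a minimiser of smaller index
      than \<open>i0\<close>.\<close>
    have "indicator (if i0 < i then {x i<..} else {x i..}) (x i0) = (0 :: ennreal)"
      using False le[OF i] least[OF i] i0 by (auto simp: indicator_def)
    then have "(\<Prod>k\<in>I - {i}. indicator (if k < i then {x i<..} else {x i..}) (x k)) = (0 :: ennreal)"
      using False i0 assms(1) by (intro prod_zero bexI[of _ i0]) auto
    then show ?thesis using False by simp
  qed
  then show ?thesis using i0 assms by (simp cong: sum.cong)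
qed

text \<open>The density of rate 1 times \<open>exp (- y) ^ n\<close>, scaled by
  \<open>Suc n\<close>, is the density of rate \<open>Suc n\<close>. The scale will count the
  candidates for the minimum, and the power will come from shifting the other \<open>n\<close>
  variables.\<close>

lemma nn_integral_exp_measure_exp_power:
  assumes [measurable]: "h \<in> borel_measurable borel"
  shows "of_nat (Suc n) * (\<integral>\<^sup>+ y. h y * ennreal (exp (- y)) ^ n \<partial>exp_measure 1) = (\<integral>\<^sup>+ y. h y \<partial>exp_measure (real (Suc n)))"
proof -
  have "of_nat (Suc n) * (\<integral>\<^sup>+ y. h y * ennreal (exp (- y)) ^ n \<partial>exp_measure 1)
      = (\<integral>\<^sup>+ y. of_nat (Suc n) * (ennreal (exponential_density 1 y) * (h y * ennreal (exp (- y)) ^ n)) \<partial>lborel)"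
    by (subst nn_integral_density) (auto simp: nn_integral_cmult)
  also have "\<dots> = (\<integral>\<^sup>+ y. ennreal (exponential_density (real (Suc n)) y) * h y \<partial>lborel)"
  proof (intro nn_integral_cong)
    fix y :: real
    have real: "exponential_density (real (Suc n)) y = real (Suc n) * (exponential_density 1 y * exp (- y) ^ n)"
      by (simp add: exponential_density_def exp_of_nat_mult[symmetric] exp_add[symmetric] algebra_simps)
    have "ennreal (real (Suc n)) * (ennreal (exponential_density 1 y) * ennreal (exp (- y) ^ n))
        = ennreal (exponential_density (real (Suc n)) y)"
      unfolding real by (simp add: ennreal_mult exponential_density_nonneg del: of_nat_Suc)
    then show "of_nat (Suc n) * (ennreal (exponential_density 1 y) * (h y * ennreal (exp (- y)) ^ n))
        = ennreal (exponential_density (real (Suc n)) y) * h y"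
      by (simp add: ennreal_power ennreal_of_nat_eq_real_of_nat mult_ac del: of_nat_Suc)
  qed
  also have "\<dots> = (\<integral>\<^sup>+ y. h y \<partial>exp_measure (real (Suc n)))"
    by (subst nn_integral_density) auto
  finally show ?thesis .
qed

text \<open>Serves the pairwise comparisons behind the minimum and, later, the events that
  coordinate \<open>r\<close> dominates; both occur with \<open><\<close> and with
  \<open>\<le>\<close>.\<close>

lemma sets_PiM_Collect_compare:
  fixes R :: "real \<Rightarrow> real \<Rightarrow> bool"
  assumes "R = (<) \<or> R = (\<le>)" "finite J" "J \<subseteq> I" "r \<in> I"
  shows "{y \<in> space (PiM I (\<lambda>_. borel)). \<forall>k\<in>J. R (y k) (y r)} \<in> sets (PiM I (\<lambda>_. borel))"
proof (intro sets.sets_Collect_finite_All)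
  fix k assume "k \<in> J"
  then have [measurable]: "k \<in> I" "r \<in> I" using assms by auto
  from assms(1) show "{y \<in> space (PiM I (\<lambda>_. borel)). R (y k) (y r)} \<in> sets (PiM I (\<lambda>_. borel))"
    by (elim disjE; simp only:; measurable)
qed fact

text \<open>This is Sukhatme's theorem tested against products of functions, by induction on the
  sample size. Deleting the minimiser from \<open>I\<close> can leave any subset, hence the general
  finite index set. Gap \<open>j\<close> has rate \<open>n - j\<close>, the number of variables not
  yet passed.\<close>

lemma nn_integral_prod_gap:
  fixes I :: "'i::linorder set" and g :: "nat \<Rightarrow> real \<Rightarrow> ennreal"
  assumes "finite I" "card I = n" "\<And>j. g j \<in> borel_measurable borel"
  shows "(\<integral>\<^sup>+ x. (\<Prod>j<n. g j (gap (sort (map x (sorted_list_of_set I))) j)) \<partial>PiM I (\<lambda>_. exp_measure 1))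
    = (\<Prod>j<n. \<integral>\<^sup>+ y. g j y \<partial>exp_measure (real (n - j)))"
  using assms
proof (induction n arbitrary: I g)
  case 0
  interpret product_sigma_finite "\<lambda>_::'i. exp_measure 1" by (rule product_sigma_finite_exp_measure) simp
  show ?case using 0 by (simp add: PiM_empty nn_integral_count_space_finite)
next
  case (Suc n)
  interpret product_sigma_finite "\<lambda>_::'i. exp_measure 1" by (rule product_sigma_finite_exp_measure) simp
  note [measurable] = Suc.prems(3)
  have sJ: "sets (PiM K (\<lambda>_. exp_measure 1)) = sets (PiM K (\<lambda>_. borel))" for K :: "'i set"
    by (intro sets_PiM_cong) auto
  have gapm: "(\<lambda>x. \<Prod>j<m. g' j (gap (sort (map x (sorted_list_of_set K))) j)) \<in> borel_measurable (PiM K (\<lambda>_. borel))"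
    if "finite K" "card K = m" "\<And>j. g' j \<in> borel_measurable borel" for K :: "'i set" and m and g' :: "nat \<Rightarrow> real \<Rightarrow> ennreal"
    using that
    by (intro borel_measurable_prod_ennreal measurable_compose[OF _ that(3)] borel_measurable_gap_sort) auto
  \<comment> \<open>\<open>A i\<close> is the indicator that \<open>x i\<close> is the minimum and
    \<open>i\<close> the least index attaining it.\<close>
  define A :: "'i \<Rightarrow> ('i \<Rightarrow> real) \<Rightarrow> ennreal"
    where "A i x = (\<Prod>k\<in>I - {i}. indicator (if k < i then {x i<..} else {x i..}) (x k))" for i x
  define \<Phi> where "\<Phi> x = (\<Prod>j<Suc n. g j (gap (sort (map x (sorted_list_of_set I))) j))" for x
  have [measurable]: "\<Phi> \<in> borel_measurable (PiM I (\<lambda>_. borel))"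
    unfolding \<Phi>_def using Suc.prems by (intro gapm) auto
  have [measurable]: "A i \<in> borel_measurable (PiM I (\<lambda>_. borel))" if i: "i \<in> I" for i
    unfolding A_def
  proof (intro borel_measurable_prod_ennreal)
    fix k assume "k \<in> I - {i}"
    then have sets: "{x \<in> space (PiM I (\<lambda>_. borel)). R (x i) (x k)} \<in> sets (PiM I (\<lambda>_. borel))"
      if "R = (<) \<or> R = (\<le>)" for R :: "real \<Rightarrow> real \<Rightarrow> bool"
      using sets_PiM_Collect_compare[of R "{i}" I k] that i by simp
    have "(\<lambda>x :: 'i \<Rightarrow> real. indicator (if k < i then {x i<..} else {x i..}) (x k) :: ennreal)
       = (\<lambda>x. if k < i then (if x i < x k then 1 else 0) else (if x i \<le> x k then 1 else 0))"
      by (auto simp: fun_eq_iff indicator_def)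
    also have "\<dots> \<in> borel_measurable (PiM I (\<lambda>_. borel))"
      using sets[of "(<)"] sets[of "(\<le>)"] by (cases "k < i") (simp_all add: measurable_If)
    finally show "(\<lambda>x :: 'i \<Rightarrow> real. indicator (if k < i then {x i<..} else {x i..}) (x k) :: ennreal)
       \<in> borel_measurable (PiM I (\<lambda>_. borel))" .
  qed
  \<comment> \<open>The value is the same for every \<open>i\<close>: the minimum contributes the
    integral over \<open>y\<close>, the shifted remainder the product given by the induction
    hypothesis.\<close>
  have part: "(\<integral>\<^sup>+ x. A i x * \<Phi> x \<partial>PiM I (\<lambda>_. exp_measure 1))
      = (\<integral>\<^sup>+ y. g 0 y * ennreal (exp (- y)) ^ n \<partial>exp_measure 1) * (\<Prod>j<n. \<integral>\<^sup>+ y. g (Suc j) y \<partial>exp_measure (real (n - j)))"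
    if i: "i \<in> I" for i
  proof -
    define J where "J = I - {i}"
    have J: "finite J" "i \<notin> J" "I = insert i J" "card J = n" using i Suc.prems by (auto simp: J_def)
    define H where "H z = (\<Prod>j<n. g (Suc j) (gap (sort (map z (sorted_list_of_set J))) j))" for z
    have Hm: "H \<in> borel_measurable (PiM J (\<lambda>_. borel))"
      unfolding H_def using Suc.prems J by (intro gapm) auto
    have "(\<lambda>x. A i x * \<Phi> x) \<in> borel_measurable (PiM I (\<lambda>_. borel))"
      using i by measurable
    then have m: "(\<lambda>x. A i x * \<Phi> x) \<in> borel_measurable (PiM (insert i J) (\<lambda>_. exp_measure 1))"
      using sJ[of I] J by (simp cong: measurable_cong_sets)
    \<comment> \<open>When \<open>x i\<close> is minimal, the first gap is \<open>x i\<close> and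
      the others are the gaps of the excesses; if some \<open>x k\<close> lies below
      \<open>x i\<close>, both sides vanish.\<close>
    have split: "A i x * \<Phi> x = g 0 (x i) * ((\<Prod>k\<in>J. indicator (if k < i then {x i<..} else {x i..}) (x k))
          * H (\<lambda>k\<in>J. x k - x i))" for x
    proof (cases "\<forall>k\<in>J. x i \<le> x k")
      case True
      have "sort (map x (sorted_list_of_set I))
        = x i # map (\<lambda>y. y + x i) (sort (map (\<lambda>k\<in>J. x k - x i) (sorted_list_of_set J)))"
      proof -
        have "map (\<lambda>k\<in>J. x k - x i) (sorted_list_of_set J) = map (\<lambda>k. x k - x i) (sorted_list_of_set J)"
          using J by (intro map_cong) auto
        moreover have "sort (map x (sorted_list_of_set I))
          = x i # map (\<lambda>y. y + x i) (sort (map (\<lambda>k. x k - x i) (sorted_list_of_set J)))"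
          unfolding J(3) using True J by (intro sort_insert_min) auto
        ultimately show ?thesis by (simp only:)
      qed
      then have "\<Phi> x = g 0 (x i) * H (\<lambda>k\<in>J. x k - x i)"
        unfolding \<Phi>_def H_def using J
        by (simp add: prod.lessThan_Suc_shift gap_Cons_Suc del: prod.lessThan_Suc)
      then show ?thesis by (simp add: A_def J_def mult_ac)
    next
      case False
      then obtain k where k: "k \<in> J" "x k < x i" by force
      then have "indicator (if k < i then {x i<..} else {x i..}) (x k) = (0 :: ennreal)"
        by (auto simp: indicator_def)
      then have "(\<Prod>k\<in>J. indicator (if k < i then {x i<..} else {x i..}) (x k)) = (0 :: ennreal)"
        using k J(1) by (intro prod_zero bexI[of _ k])
      then show ?thesis by (simp only: A_def J_def[symmetric]) simp
    qed
    have "(\<integral>\<^sup>+ x. A i x * \<Phi> x \<partial>PiM I (\<lambda>_. exp_measure 1))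
      = (\<integral>\<^sup>+ y. \<integral>\<^sup>+ x. A i (x(i := y)) * \<Phi> (x(i := y)) \<partial>PiM J (\<lambda>_. exp_measure 1) \<partial>exp_measure 1)"
      unfolding J(3) using J m by (intro product_nn_integral_insert_rev) auto
    also have "\<dots> = (\<integral>\<^sup>+ y. \<integral>\<^sup>+ x. g 0 y * ((\<Prod>k\<in>J. indicator (if k < i then {y<..} else {y..}) (x k))
          * H (\<lambda>k\<in>J. x k - y)) \<partial>PiM J (\<lambda>_. exp_measure 1) \<partial>exp_measure 1)"
    proof (intro nn_integral_cong)
      fix x :: "'i \<Rightarrow> real" and y :: real
      have "(\<Prod>k\<in>J. indicator (if k < i then {y<..} else {y..}) ((x(i := y)) k))
         = (\<Prod>k\<in>J. indicator (if k < i then {y<..} else {y..}) (x k) :: ennreal)"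
        using J by (intro prod.cong) auto
      moreover have "(\<lambda>k\<in>J. (x(i := y)) k - y) = (\<lambda>k\<in>J. x k - y)"
        using J by (auto simp: fun_eq_iff)
      ultimately show "A i (x(i := y)) * \<Phi> (x(i := y)) = g 0 y * ((\<Prod>k\<in>J. indicator (if k < i then {y<..} else {y..}) (x k))
          * H (\<lambda>k\<in>J. x k - y))"
        unfolding split by (simp only: fun_upd_same)
    qed
    also have "\<dots> = (\<integral>\<^sup>+ y. (g 0 y * ennreal (exp (- y)) ^ n) * (\<integral>\<^sup>+ x. H x \<partial>PiM J (\<lambda>_. exp_measure 1)) \<partial>exp_measure 1)"
    proof (rule nn_integral_cong_AE)
      \<comment> \<open>Memorylessness is available for shifts \<open>y \<ge> 0\<close>, which is
        almost every \<open>y\<close> under the exponential law.\<close>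
      have "AE y in exp_measure 1. 0 \<le> y"
        by (subst AE_density) (auto simp: exponential_density_def)
      then show "AE y in exp_measure 1. (\<integral>\<^sup>+ x. g 0 y * ((\<Prod>k\<in>J. indicator (if k < i then {y<..} else {y..}) (x k))
          * H (\<lambda>k\<in>J. x k - y)) \<partial>PiM J (\<lambda>_. exp_measure 1))
          = (g 0 y * ennreal (exp (- y)) ^ n) * (\<integral>\<^sup>+ x. H x \<partial>PiM J (\<lambda>_. exp_measure 1))"
      proof eventually_elim
        case (elim y)
        have "(\<lambda>x. (\<Prod>k\<in>J. indicator (if k < i then {y<..} else {y..}) (x k)) * H (\<lambda>k\<in>J. x k - y))
            \<in> borel_measurable (PiM J (\<lambda>_. borel))"
        proof -
          define U where "U k = (if k < i then {y<..} else {y..})" for k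
          have [measurable]: "U k \<in> sets borel" for k by (simp add: U_def)
          note Hm[measurable]
          show ?thesis unfolding U_def[symmetric] by measurable
        qed
        then have "(\<lambda>x. (\<Prod>k\<in>J. indicator (if k < i then {y<..} else {y..}) (x k)) * H (\<lambda>k\<in>J. x k - y))
            \<in> borel_measurable (PiM J (\<lambda>_. exp_measure 1))"
          using sJ[of J] by (simp cong: measurable_cong_sets)
        then show ?case using elim J Hm
          by (subst nn_integral_cmult, simp)
             (subst PiM_exp_measure_memoryless[where U = "\<lambda>k. if k < i then {y<..} else {y..}"], auto simp: mult_ac)
      qed
    qed
    also have "\<dots> = (\<integral>\<^sup>+ y. g 0 y * ennreal (exp (- y)) ^ n \<partial>exp_measure 1) * (\<integral>\<^sup>+ x. H x \<partial>PiM J (\<lambda>_. exp_measure 1))"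
      by (rule nn_integral_multc) auto
    also have "(\<integral>\<^sup>+ x. H x \<partial>PiM J (\<lambda>_. exp_measure 1)) = (\<Prod>j<n. \<integral>\<^sup>+ y. g (Suc j) y \<partial>exp_measure (real (n - j)))"
      unfolding H_def using J Suc.prems by (intro Suc.IH) auto
    finally show ?thesis .
  qed
  \<comment> \<open>The indicators \<open>A i\<close> sum to 1 at every point, so they may be
    inserted under the integral.\<close>
  have "(\<integral>\<^sup>+ x. \<Phi> x \<partial>PiM I (\<lambda>_. exp_measure 1)) = (\<integral>\<^sup>+ x. (\<Sum>i\<in>I. A i x * \<Phi> x) \<partial>PiM I (\<lambda>_. exp_measure 1))"
    using Suc.prems unfolding A_def sum_distrib_right[symmetric]
    by (subst sum_min_indicator) auto
  also have "\<dots> = (\<Sum>i\<in>I. \<integral>\<^sup>+ x. A i x * \<Phi> x \<partial>PiM I (\<lambda>_. exp_measure 1))"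
  proof (rule nn_integral_sum)
    fix i assume "i \<in> I"
    then have "(\<lambda>x. A i x * \<Phi> x) \<in> borel_measurable (PiM I (\<lambda>_. borel))" by measurable
    then show "(\<lambda>x. A i x * \<Phi> x) \<in> borel_measurable (PiM I (\<lambda>_. exp_measure 1))"
      using sJ[of I] by (simp cong: measurable_cong_sets)
  qed
  \<comment> \<open>There are \<open>Suc n\<close> equal terms; this factor gives the minimum its
    rate \<open>Suc n\<close>.\<close>
  also have "\<dots> = (of_nat (Suc n) * (\<integral>\<^sup>+ y. g 0 y * ennreal (exp (- y)) ^ n \<partial>exp_measure 1))
      * (\<Prod>j<n. \<integral>\<^sup>+ y. g (Suc j) y \<partial>exp_measure (real (n - j)))"
    using Suc.prems(2) by (simp add: part mult.assoc del: of_nat_Suc cong: sum.cong)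
  also have "\<dots> = (\<Prod>j<Suc n. \<integral>\<^sup>+ y. g j y \<partial>exp_measure (real (Suc n - j)))"
    unfolding nn_integral_exp_measure_exp_power[OF Suc.prems(3)[of 0]]
    by (simp only: prod.lessThan_Suc_shift diff_Suc_Suc diff_zero)
  finally show ?case unfolding \<Phi>_def .
qed


section \<open>Sukhatme's representation\<close>

text \<open>Equality of the joint law with a product measure expresses independence and the marginal
  laws at once. The order is reversed so that coordinate \<open>r\<close> has rate \<open>r\<close>.
  The two measures agree on rectangles by the product formula for gaps, taken with indicator
  functions.\<close>

lemma Sukhatme_spacings:
  fixes X :: "nat \<Rightarrow> 'a \<Rightarrow> real"
  assumes "prob_space M" and n: "n \<ge> 1"
    and indep: "prob_space.indep_vars M (\<lambda>_. borel) X {1..n}"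
    and dist: "\<And>i. i \<in> {1..n} \<Longrightarrow> distributed M lborel (X i) (exponential_density 1)"
  shows "distr M (PiM {1..n} (\<lambda>_. borel)) (\<lambda>\<omega>. \<lambda>r\<in>{1..n}. spacing X n (n - r + 1) \<omega>)
    = PiM {1..n} (\<lambda>r. exp_measure (real r))"
proof -
  interpret prob_space M by fact
  interpret product_sigma_finite "\<lambda>r::nat. exp_measure (real r)" by (rule product_sigma_finite_exp_measure) simp
  have X[measurable]: "X i \<in> borel_measurable M" if "i \<in> {1..n}" for i
    using distributed_measurable[OF dist[OF that]] by simp
  have eq: "distr M (PiM {1..n} (\<lambda>_. borel)) (\<lambda>\<omega>. \<lambda>i\<in>{1..n}. X i \<omega>) = PiM {1..n} (\<lambda>_. exp_measure 1)"
  proof -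
    have "distr M (PiM {1..n} (\<lambda>_. borel)) (\<lambda>\<omega>. \<lambda>i\<in>{1..n}. X i \<omega>) = PiM {1..n} (\<lambda>i. distr M borel (X i))"
      using n X indep indep_vars_iff_distr_eq_PiM'[of "{1..n}" X "\<lambda>_. borel"] by auto
    also have "\<dots> = PiM {1..n} (\<lambda>_. exp_measure 1)"
    proof (rule PiM_cong[OF refl])
      fix i assume "i \<in> {1..n}"
      then show "distr M borel (X i) = exp_measure 1"
        using distributed_distr_eq_density[OF dist] by (metis distr_cong sets_lborel)
    qed
    finally show ?thesis .
  qed
  \<comment> \<open>The spacing with one-based index \<open>n - r + 1\<close> is the zero-based gap
    \<open>n - r\<close>.\<close>
  have gap_eq: "spacing X n (n - r + 1) \<omega>
      = gap (sort (map (\<lambda>i\<in>{1..n}. X i \<omega>) (sorted_list_of_set {1..n}))) (n - r)" for r \<omega>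
  proof -
    have "sorted_list_of_set {1..n} = [1..<Suc n]"
      using sorted_list_of_set_range[of 1 "Suc n"] by (simp only: atLeastLessThanSuc_atLeastAtMost)
    then have "map (\<lambda>i\<in>{1..n}. X i \<omega>) (sorted_list_of_set {1..n}) = map (\<lambda>i. X i \<omega>) [1..<Suc n]"
      by (metis (mono_tags, lifting) finite_atLeastAtMost map_cong restrict_apply' set_sorted_list_of_set)
    then show ?thesis by (simp add: spacing_def order_stat_def gap_def del: upt_Suc One_nat_def)
  qed
  have gapm[measurable]: "(\<lambda>x. gap (sort (map x (sorted_list_of_set {1..n}))) (n - r)) \<in> borel_measurable (PiM {1..n} (\<lambda>_. borel))"
    if "r \<in> {1..n}" for r
    using that by (intro borel_measurable_gap_sort) auto
  have Xm[measurable]: "(\<lambda>\<omega>. \<lambda>i\<in>{1..n}. X i \<omega>) \<in> measurable M (PiM {1..n} (\<lambda>_. borel))"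
    by measurable
  have sm: "(\<lambda>\<omega>. \<lambda>r\<in>{1..n}. spacing X n (n - r + 1) \<omega>) \<in> measurable M (PiM {1..n} (\<lambda>_. borel))"
    unfolding gap_eq by (intro measurable_restrict measurable_compose[OF Xm gapm])
  show ?thesis
  proof (rule PiM_eqI)
    show "sets (distr M (PiM {1..n} (\<lambda>_. borel)) (\<lambda>\<omega>. \<lambda>r\<in>{1..n}. spacing X n (n - r + 1) \<omega>))
      = sets (PiM {1..n} (\<lambda>r. exp_measure (real r)))"
      by (simp, intro sets_PiM_cong) auto
  next
    fix A assume "\<And>i. i \<in> {1..n} \<Longrightarrow> A i \<in> sets (exp_measure (real i))"
    then have A[measurable]: "\<And>i. i \<in> {1..n} \<Longrightarrow> A i \<in> sets borel" by simp
    \<comment> \<open>For \<open>j \<ge> n\<close> the index \<open>n - j\<close> is 0, where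
      nothing is known about \<open>A\<close>; the value 0 keeps every \<open>g j\<close>
      measurable.\<close>
    define g :: "nat \<Rightarrow> real \<Rightarrow> ennreal" where "g j = (if j < n then indicator (A (n - j)) else (\<lambda>_. 0))" for j
    have meas: "(\<lambda>x. \<Prod>j<n. g j (gap (sort (map x (sorted_list_of_set {1..n}))) j)) \<in> borel_measurable (PiM {1..n} (\<lambda>_. borel))"
    proof (intro borel_measurable_prod_ennreal)
      fix j assume j: "j \<in> {..<n}"
      have gj: "g j \<in> borel_measurable borel" using j by (auto simp: g_def)
      show "(\<lambda>x. g j (gap (sort (map x (sorted_list_of_set {1..n}))) j)) \<in> borel_measurable (PiM {1..n} (\<lambda>_. borel))"
        using j by (intro measurable_compose[OF borel_measurable_gap_sort gj]) auto
    qed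
    have reindex: "(\<Prod>r\<in>{1..n}. f r) = (\<Prod>j<n. f (n - j))" for f :: "nat \<Rightarrow> ennreal"
      by (rule prod.reindex_bij_witness[where i = "\<lambda>j. n - j" and j = "\<lambda>r. n - r"]) auto
    have "emeasure (distr M (PiM {1..n} (\<lambda>_. borel)) (\<lambda>\<omega>. \<lambda>r\<in>{1..n}. spacing X n (n - r + 1) \<omega>)) (Pi\<^sub>E {1..n} A)
      = (\<integral>\<^sup>+ \<omega>. indicator (Pi\<^sub>E {1..n} A) (\<lambda>r\<in>{1..n}. spacing X n (n - r + 1) \<omega>) \<partial>M)"
      using sm by (subst nn_integral_indicator[symmetric], force intro!: sets_PiM_I_finite)
                  (subst nn_integral_distr, auto intro!: sets_PiM_I_finite)
    also have "\<dots> = (\<integral>\<^sup>+ \<omega>. (\<Prod>r\<in>{1..n}. indicator (A r) (spacing X n (n - r + 1) \<omega>)) \<partial>M)"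
      by (intro nn_integral_cong) (auto simp: indicator_def PiE_iff prod_zero_iff)
    also have "\<dots> = (\<integral>\<^sup>+ \<omega>. (\<Prod>j<n. g j (gap (sort (map (\<lambda>i\<in>{1..n}. X i \<omega>) (sorted_list_of_set {1..n}))) j)) \<partial>M)"
      unfolding reindex gap_eq by (intro nn_integral_cong prod.cong) (auto simp: g_def)
    also have "\<dots> = (\<integral>\<^sup>+ x. (\<Prod>j<n. g j (gap (sort (map x (sorted_list_of_set {1..n}))) j)) \<partial>PiM {1..n} (\<lambda>_. exp_measure 1))"
      unfolding eq[symmetric] using meas by (intro nn_integral_distr[OF Xm, symmetric]) simp
    also have "\<dots> = (\<Prod>j<n. \<integral>\<^sup>+ y. g j y \<partial>exp_measure (real (n - j)))"
      by (intro nn_integral_prod_gap) (auto simp: g_def)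
    also have "\<dots> = (\<Prod>r\<in>{1..n}. emeasure (exp_measure (real r)) (A r))"
      unfolding reindex by (intro prod.cong) (auto simp: g_def)
    finally show "emeasure (distr M (PiM {1..n} (\<lambda>_. borel)) (\<lambda>\<omega>. \<lambda>r\<in>{1..n}. spacing X n (n - r + 1) \<omega>)) (Pi\<^sub>E {1..n} A)
      = (\<Prod>r\<in>{1..n}. emeasure (exp_measure (real r)) (A r))" .
  qed simp
qed

section \<open>The probability that one of several independent exponentials is the largest\<close>

text \<open>The endpoint \<open>t\<close> is null, so the distribution function gives the value for
  \<open><\<close> and for \<open>\<le>\<close> alike.\<close>

lemma emeasure_exp_measure_below:
  assumes "0 < l" "0 \<le> t" and U: "{..<t} \<subseteq> U" "U \<subseteq> {..t}" "U \<in> sets borel"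
  shows "emeasure (exp_measure l) U = ennreal (1 - exp (- l * t))"
proof -
  have "AE x in exp_measure l. x \<noteq> t"
    using AE_lborel_singleton[of t] by (subst AE_density) (auto elim: eventually_mono)
  then have "emeasure (exp_measure l) U = emeasure (exp_measure l) {..t}"
    using U by (intro emeasure_eq_AE) (auto elim!: eventually_mono)
  then show ?thesis using assms by (simp add: emeasure_erlang_density erlang_CDF_0)
qed

text \<open>Fubini with coordinate \<open>r\<close> outermost: given \<open>y r = t\<close>, the
  other coordinates lie below \<open>t\<close> independently, coordinate \<open>k\<close> with
  probability \<open>1 - exp (- real k * t)\<close>. The value is the same for both choices of
  \<open>R\<close>, which makes ties harmless.\<close>

lemma emeasure_PiM_exp_measure_max:
  assumes R: "R = (<) \<or> R = (\<le>)" and r: "r \<in> {1..n}"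
  shows "emeasure (PiM {1..n} (\<lambda>k. exp_measure (real k))) {y \<in> space (PiM {1..n} (\<lambda>_. borel)). \<forall>k\<in>{1..n} - {r}. R (y k) (y r)}
    = (\<integral>\<^sup>+ t. ennreal (indicator {0<..} t * (real r * exp (- real r * t) * (\<Prod>k\<in>{1..n} - {r}. 1 - exp (- real k * t)))) \<partial>lborel)"
proof -
  interpret product_sigma_finite "\<lambda>r::nat. exp_measure (real r)" by (rule product_sigma_finite_exp_measure) simp
  define J where "J = {1..n} - {r}"
  have J: "finite J" "r \<notin> J" "{1..n} = insert r J" using r by (auto simp: J_def)
  define S where "S = {y \<in> space (PiM {1..n} (\<lambda>_. borel :: real measure)). \<forall>k\<in>J. R (y k) (y r)}"
  have sets_eq: "sets (PiM K (\<lambda>k. exp_measure (real k))) = sets (PiM K (\<lambda>_. borel))" for K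
    by (intro sets_PiM_cong) auto
  have Rm: "{s. R s t} \<in> sets borel" "{..<t} \<subseteq> {s. R s t}" "{s. R s t} \<subseteq> {..t}" for t :: real
    using R by (auto simp: lessThan_def[symmetric] atMost_def[symmetric])
  have "S \<in> sets (PiM {1..n} (\<lambda>_. borel))"
    unfolding S_def using R J by (intro sets_PiM_Collect_compare) auto
  then have S: "S \<in> sets (PiM (insert r J) (\<lambda>k. exp_measure (real k)))"
    using sets_eq J by simp
  have "emeasure (PiM {1..n} (\<lambda>k. exp_measure (real k))) S
    = (\<integral>\<^sup>+ t. \<integral>\<^sup>+ x. indicator S (x(r := t)) \<partial>PiM J (\<lambda>k. exp_measure (real k)) \<partial>exp_measure (real r))"
  proof -
    have "emeasure (PiM (insert r J) (\<lambda>k. exp_measure (real k))) S = (\<integral>\<^sup>+ x. indicator S x \<partial>PiM (insert r J) (\<lambda>k. exp_measure (real k)))"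
      using S by simp
    also have "\<dots> = (\<integral>\<^sup>+ t. \<integral>\<^sup>+ x. indicator S (x(r := t)) \<partial>PiM J (\<lambda>k. exp_measure (real k)) \<partial>exp_measure (real r))"
      using S J(1,2) by (intro product_nn_integral_insert_rev) simp_all
    finally show ?thesis using J(3) by simp
  qed
  also have "\<dots> = (\<integral>\<^sup>+ t. \<integral>\<^sup>+ x. (\<Prod>k\<in>J. indicator {s. R s t} (x k)) \<partial>PiM J (\<lambda>k. exp_measure (real k)) \<partial>exp_measure (real r))"
  proof (intro nn_integral_cong)
    fix t x assume "x \<in> space (PiM J (\<lambda>k. exp_measure (real k)))"
    then have "x(r := t) \<in> space (PiM {1..n} (\<lambda>_. borel))"
      unfolding J(3) by (auto simp: space_PiM PiE_iff extensional_def)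
    moreover have "(\<forall>k\<in>J. R ((x(r := t)) k) ((x(r := t)) r)) \<longleftrightarrow> (\<forall>k\<in>J. R (x k) t)"
      using J by auto
    ultimately show "indicator S (x(r := t)) = (\<Prod>k\<in>J. indicator {s. R s t} (x k) :: ennreal)"
      using J(1) by (auto simp: S_def indicator_def prod_zero_iff)
  qed
  also have "\<dots> = (\<integral>\<^sup>+ t. (\<Prod>k\<in>J. emeasure (exp_measure (real k)) {s. R s t}) \<partial>exp_measure (real r))"
  proof (intro nn_integral_cong)
    fix t
    show "(\<integral>\<^sup>+ x. (\<Prod>k\<in>J. indicator {s. R s t} (x k)) \<partial>PiM J (\<lambda>k. exp_measure (real k)))
      = (\<Prod>k\<in>J. emeasure (exp_measure (real k)) {s. R s t})"
      using J Rm by (subst product_nn_integral_prod) auto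
  qed
  also have "\<dots> = (\<integral>\<^sup>+ t. ennreal (\<Prod>k\<in>J. 1 - exp (- real k * t)) \<partial>exp_measure (real r))"
  proof (rule nn_integral_cong_AE)
    have "AE t in exp_measure (real r). 0 \<le> t"
      by (subst AE_density) (auto simp: exponential_density_def)
    then show "AE t in exp_measure (real r). (\<Prod>k\<in>J. emeasure (exp_measure (real k)) {s. R s t}) = ennreal (\<Prod>k\<in>J. 1 - exp (- real k * t))"
    proof eventually_elim
      case (elim t)
      have "(\<Prod>k\<in>J. emeasure (exp_measure (real k)) {s. R s t}) = (\<Prod>k\<in>J. ennreal (1 - exp (- real k * t)))"
        using elim Rm[of t] by (intro prod.cong refl emeasure_exp_measure_below) (auto simp: J_def)
      also have "\<dots> = ennreal (\<Prod>k\<in>J. 1 - exp (- real k * t))"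
        using elim by (intro prod_ennreal) auto
      finally show ?case .
    qed
  qed
  also have "\<dots> = (\<integral>\<^sup>+ t. ennreal (exponential_density (real r) t) * ennreal (\<Prod>k\<in>J. 1 - exp (- real k * t)) \<partial>lborel)"
    by (subst nn_integral_density) auto
  also have "\<dots> = (\<integral>\<^sup>+ t. ennreal (indicator {0<..} t * (real r * exp (- real r * t) * (\<Prod>k\<in>J. 1 - exp (- real k * t)))) \<partial>lborel)"
  proof (rule nn_integral_cong_AE)
    show "AE t in lborel. ennreal (exponential_density (real r) t) * ennreal (\<Prod>k\<in>J. 1 - exp (- real k * t))
      = ennreal (indicator {0<..} t * (real r * exp (- real r * t) * (\<Prod>k\<in>J. 1 - exp (- real k * t))))"
      \<comment> \<open>The point \<open>t = 0\<close> is set aside because the density is positive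
        there while the indicator of \<open>{0<..}\<close> is 0.\<close>
      using AE_lborel_singleton[of 0]
    proof eventually_elim
      case (elim t)
      then show ?case
        by (subst ennreal_mult'[symmetric])
           (auto simp: exponential_density_def indicator_def mult_ac)
    qed
  qed
  finally show ?thesis unfolding S_def J_def .
qed

section \<open>The index of the largest spacing\<close>

text \<open>Exhibits the choice as a function of the set of maximisers alone, which reduces
  measurability of the index to that of this set.\<close>

lemma arg_max_on_eq_SOME:
  fixes f :: "'a \<Rightarrow> 'b::linorder"
  shows "arg_max_on f S = (SOME i. i \<in> {i \<in> S. \<forall>j\<in>S. f j \<le> f i})"
  unfolding arg_max_on_def arg_max_def is_arg_max_def by (simp add: not_less Ball_def)

text \<open>The rank factors through the finite set \<open>T\<close> of maximisers. Each event
  \<open>T \<omega> = B\<close> is a finite Boolean combination of comparisons of spacings, and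
  every map out of a discrete space is measurable, so the unspecified choice does no harm.\<close>

lemma measurable_max_spacing_rank:
  fixes X :: "nat \<Rightarrow> 'a \<Rightarrow> real"
  assumes "\<And>j. j \<in> {1..n} \<Longrightarrow> spacing X n j \<in> borel_measurable M"
  shows "max_spacing_rank X n \<in> measurable M (count_space UNIV)"
proof -
  define T where "T \<omega> = {i \<in> {1..n}. \<forall>j\<in>{1..n}. spacing X n j \<omega> \<le> spacing X n i \<omega>}" for \<omega>
  note [measurable] = assms
  have "T \<in> measurable M (count_space (Pow {1..n}))"
  proof (subst measurable_count_space_eq2, simp, intro conjI ballI)
    show "T \<in> space M \<rightarrow> Pow {1..n}" by (auto simp: T_def)
    fix B assume B: "B \<in> Pow {1..n}"
    have eq: "T \<omega> = B \<longleftrightarrow> (\<forall>i\<in>{1..n}. (\<forall>j\<in>{1..n}. spacing X n j \<omega> \<le> spacing X n i \<omega>) \<longleftrightarrow> i \<in> B)" for \<omega>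
    proof -
      have "T \<omega> = B \<longleftrightarrow> (\<forall>i\<in>{1..n}. i \<in> T \<omega> \<longleftrightarrow> i \<in> B)"
        using B unfolding T_def by blast
      then show ?thesis by (simp add: T_def)
    qed
    have "T -` {B} \<inter> space M = {\<omega> \<in> space M. T \<omega> = B}" by blast
    also have "\<dots> = {\<omega> \<in> space M. \<forall>i\<in>{1..n}. (\<forall>j\<in>{1..n}. spacing X n j \<omega> \<le> spacing X n i \<omega>) \<longleftrightarrow> i \<in> B}"
      by (simp only: eq)
    also have "\<dots> \<in> sets M" by measurable
    finally show "T -` {B} \<inter> space M \<in> sets M" .
  qed
  then have "(\<lambda>\<omega>. n - (SOME i. i \<in> T \<omega>) + 1) \<in> measurable M (count_space UNIV)"
    by (rule measurable_compose) simp
  then show ?thesis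
    unfolding max_spacing_rank_def[abs_def] max_spacing_index_def arg_max_on_eq_SOME T_def .
qed

text \<open>A finite nonempty index set has a maximiser, so the choice does pick one. The bracketing
  of the rank event below uses no more than this about ties.\<close>

lemma max_spacing_index_maximal:
  assumes "n \<ge> 1"
  shows "max_spacing_index X n \<omega> \<in> {1..n}"
    and "j \<in> {1..n} \<Longrightarrow> spacing X n j \<omega> \<le> spacing X n (max_spacing_index X n \<omega>) \<omega>"
proof -
  let ?f = "\<lambda>j. spacing X n j \<omega>"
  have "Max (?f ` {1..n}) \<in> ?f ` {1..n}" using assms by (intro Max_in) auto
  then obtain i where "i \<in> {1..n}" "?f i = Max (?f ` {1..n})" by auto
  then have "i \<in> {i \<in> {1..n}. \<forall>j\<in>{1..n}. ?f j \<le> ?f i}" by auto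
  then have *: "max_spacing_index X n \<omega> \<in> {i \<in> {1..n}. \<forall>j\<in>{1..n}. ?f j \<le> ?f i}"
    unfolding max_spacing_index_def arg_max_on_eq_SOME by (rule someI)
  show "max_spacing_index X n \<omega> \<in> {1..n}" using * by auto
  show "j \<in> {1..n} \<Longrightarrow> spacing X n j \<omega> \<le> spacing X n (max_spacing_index X n \<omega>) \<omega>" using * by auto
qed

section \<open>The two integral formulas for the rank probability\<close>

theorem proposition3p1:
  fixes M :: "'a measure" and X :: "nat \<Rightarrow> 'a \<Rightarrow> real" and n r :: nat
  assumes "prob_space M"
    and "n \<ge> 1"
    and "prob_space.indep_vars M (\<lambda>_. borel) X {1..n}"
    and "\<And>i. i \<in> {1..n} \<Longrightarrow> distributed M lborel (X i) (exponential_density 1)"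
    and "1 \<le> r" and "r \<le> n"
  shows "rank_prob M X n r =
           (LBINT t:{0<..}. real r * exp (- real r * t) *
              (\<Prod>k\<in>{1..n} - {r}. 1 - exp (- real k * t)))
       \<and> rank_prob M X n r =
           (LBINT u:{0<..<1}. real r * u ^ (r - 1) *
              (\<Prod>k\<in>{1..n} - {r}. 1 - u ^ k))"
proof -
  interpret prob_space M by fact
  define Y where "Y \<omega> = (\<lambda>k\<in>{1..n}. spacing X n (n - k + 1) \<omega>)" for \<omega>
  \<comment> \<open>On the level of \<open>Y\<close>, the event \<open>E (<)\<close> forces rank
    \<open>r\<close>, and rank \<open>r\<close> forces \<open>E (\<le>)\<close>.\<close>
  define E where "E R = {y \<in> space (PiM {1..n} (\<lambda>_. borel)). \<forall>k\<in>{1..n} - {r}. R (y k) (y r)}"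
    for R :: "real \<Rightarrow> real \<Rightarrow> bool"
  define p where "p t = real r * exp (- real r * t) * (\<Prod>k\<in>{1..n} - {r}. 1 - exp (- real k * t))" for t
  have r: "r \<in> {1..n}" using assms by auto
  have X[measurable]: "X i \<in> borel_measurable M" if "i \<in> {1..n}" for i
    using distributed_measurable[OF assms(4)[OF that]] by simp
  have sp[measurable]: "spacing X n j \<in> borel_measurable M" if "j \<in> {1..n}" for j
  proof -
    have "(\<lambda>\<omega>. gap (sort (map (\<lambda>i. X i \<omega>) [1..<Suc n])) (j - 1)) \<in> borel_measurable M"
      using that by (intro borel_measurable_gap_sort) auto
    moreover have "spacing X n j = (\<lambda>\<omega>. gap (sort (map (\<lambda>i. X i \<omega>) [1..<Suc n])) (j - 1))"
      using that by (auto simp: fun_eq_iff spacing_def order_stat_def gap_def)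
    ultimately show ?thesis by simp
  qed
  have Ym: "Y \<in> measurable M (PiM {1..n} (\<lambda>_. borel))"
    unfolding Y_def by (intro measurable_restrict sp) auto
  have Em: "E (<) \<in> sets (PiM {1..n} (\<lambda>_. borel))" "E (\<le>) \<in> sets (PiM {1..n} (\<lambda>_. borel))"
    unfolding E_def using r by (auto intro!: sets_PiM_Collect_compare)
  have val: "emeasure M (Y -` E R \<inter> space M) = (\<integral>\<^sup>+ t. ennreal (indicator {0<..} t * p t) \<partial>lborel)"
    if R: "R = (<) \<or> R = (\<le>)" for R
  proof -
    have "emeasure M (Y -` E R \<inter> space M) = emeasure (distr M (PiM {1..n} (\<lambda>_. borel)) Y) (E R)"
      using Em Ym R by (subst emeasure_distr) auto
    also have "\<dots> = emeasure (PiM {1..n} (\<lambda>k. exp_measure (real k))) (E R)"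
      unfolding Y_def[abs_def] by (subst Sukhatme_spacings[OF assms(1-4)]) auto
    finally show ?thesis unfolding E_def p_def emeasure_PiM_exp_measure_max[OF R r] .
  qed
  have Yspace: "Y \<omega> \<in> space (PiM {1..n} (\<lambda>_. borel))" for \<omega>
    by (auto simp: Y_def space_PiM)
  have lower: "Y -` E (<) \<inter> space M \<subseteq> {\<omega> \<in> space M. max_spacing_rank X n \<omega> = r}"
  proof safe
    fix \<omega> assume \<omega>: "Y \<omega> \<in> E (<)"
    let ?i = "max_spacing_index X n \<omega>"
    have i: "?i \<in> {1..n}" "spacing X n (n - r + 1) \<omega> \<le> spacing X n ?i \<omega>"
      using max_spacing_index_maximal[OF assms(2), where X = X and \<omega> = \<omega>] r by auto
    \<comment> \<open>Spacing \<open>?i\<close> is coordinate \<open>n - ?i + 1\<close> of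
      \<open>Y\<close>; not being strictly below coordinate \<open>r\<close>, it must be that
      coordinate.\<close>
    have "\<not> Y \<omega> (n - ?i + 1) < Y \<omega> r" using i r by (auto simp: Y_def Suc_diff_Suc)
    then show "max_spacing_rank X n \<omega> = r"
      using \<omega> i r by (auto simp: E_def max_spacing_rank_def)
  qed
  have upper: "{\<omega> \<in> space M. max_spacing_rank X n \<omega> = r} \<subseteq> Y -` E (\<le>) \<inter> space M"
  proof
    fix \<omega> assume "\<omega> \<in> {\<omega> \<in> space M. max_spacing_rank X n \<omega> = r}"
    then have "\<omega> \<in> space M" and \<omega>: "r = max_spacing_rank X n \<omega>" by auto
    let ?i = "max_spacing_index X n \<omega>"
    have i: "?i \<in> {1..n}" by (rule max_spacing_index_maximal(1)[OF assms(2)])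
    have "n - r + 1 = ?i" using i unfolding \<omega> max_spacing_rank_def by auto
    then have "\<forall>k\<in>{1..n}. Y \<omega> k \<le> Y \<omega> r"
      using max_spacing_index_maximal(2)[OF assms(2), where X = X and \<omega> = \<omega>] r by (auto simp: Y_def)
    then show "\<omega> \<in> Y -` E (\<le>) \<inter> space M"
      using Yspace \<open>\<omega> \<in> space M\<close> unfolding E_def by auto
  qed
  have "{\<omega> \<in> space M. max_spacing_rank X n \<omega> = r} = max_spacing_rank X n -` {r} \<inter> space M" by auto
  then have mset: "{\<omega> \<in> space M. max_spacing_rank X n \<omega> = r} \<in> sets M"
    using measurable_max_spacing_rank[of n X M, OF sp] by (simp add: measurable_sets)
  \<comment> \<open>The two bracketing events have the same measure by \<open>val\<close>, so the
    rank event is squeezed between equal bounds.\<close>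
  have em: "emeasure M {\<omega> \<in> space M. max_spacing_rank X n \<omega> = r} = (\<integral>\<^sup>+ t. ennreal (indicator {0<..} t * p t) \<partial>lborel)"
    using emeasure_mono[OF lower mset] emeasure_mono[OF upper measurable_sets[OF Ym Em(2)]] val by auto
  have pm[measurable]: "p \<in> borel_measurable borel" unfolding p_def by measurable
  have pos: "0 \<le> indicator {0<..} t * p t" for t
    unfolding p_def by (auto simp: indicator_def intro!: mult_nonneg_nonneg prod_nonneg)
  \<comment> \<open>The integral is a probability and hence finite; the substitution below relies on
    this.\<close>
  have int: "integrable lborel (\<lambda>t. indicator {0<..} t * p t)"
    using pos em emeasure_finite[of "{\<omega> \<in> space M. max_spacing_rank X n \<omega> = r}"]
    by (intro integrableI_nonneg) (auto simp: top.not_eq_extremum)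
  have first: "rank_prob M X n r = (LBINT t:{0<..}. p t)"
    unfolding rank_prob_def measure_def em set_lebesgue_integral_def
    using pos by (subst integral_eq_nn_integral) auto
  define q where "q u = real r * u ^ (r - 1) * (\<Prod>k\<in>{1..n} - {r}. 1 - u ^ k)" for u :: real
  \<comment> \<open>With \<open>u = exp x\<close> the Jacobian \<open>exp x\<close> raises
    \<open>u ^ (r - 1)\<close> to \<open>u ^ r\<close>, by \<open>r \<ge> 1\<close>; the argument
    \<open>- x\<close> plays the role of \<open>t\<close>.\<close>
  have qp: "q (exp x) * exp x = p (- x)" for x
  proof -
    have pow: "exp x ^ k = exp (- real k * - x)" for k
      by (simp add: exp_of_nat_mult)
    have "q (exp x) * exp x = real r * (exp x ^ (r - 1) * exp x) * (\<Prod>k\<in>{1..n} - {r}. 1 - exp x ^ k)"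
      unfolding q_def by (simp only: mult_ac)
    also have "exp x ^ (r - 1) * exp x = exp x ^ r"
      using assms(5) by (intro power_minus_mult) simp
    finally show ?thesis unfolding p_def pow .
  qed
  \<comment> \<open>The substitution runs along \<open>exp\<close>, which increases from 0 to 1 on
    the negative half-line; the change of sign to \<open>t\<close> follows by reflection.\<close>
  have "(LBINT u=0..1. q u) = (LBINT x=-\<infinity>..0. q (exp x) * exp x)"
  proof (rule interval_integral_substitution_nonneg(2))
    show "isCont q (exp x)" for x unfolding q_def by (intro continuous_intros)
    show "0 \<le> q (exp x)" if "ereal x < 0" for x
    proof -
      have "exp x ^ k \<le> 1" for k using that by (intro power_le_one) auto
      then show ?thesis unfolding q_def by (intro mult_nonneg_nonneg prod_nonneg) auto
    qed
    show "((ereal \<circ> exp \<circ> real_of_ereal) \<longlongrightarrow> 0) (at_right (- \<infinity>))"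
      unfolding zero_ereal_def ereal_tendsto_simps1 using exp_at_bot by (simp add: o_def)
    show "((ereal \<circ> exp \<circ> real_of_ereal) \<longlongrightarrow> 1) (at_left 0)"
    proof -
      have "(exp \<longlongrightarrow> exp (0 :: real)) (at_left 0)" by (intro tendsto_intros)
      then show ?thesis
        unfolding zero_ereal_def one_ereal_def ereal_tendsto_simps1 by (simp add: o_def)
    qed
    \<comment> \<open>Reflection carries integrability of \<open>p\<close> on the positive half-line
      over to the negative one.\<close>
    have "integrable lborel (\<lambda>x. indicator {0<..} (0 + (-1) * x) * p (0 + (-1) * x))"
      by (rule lborel_integrable_real_affine[OF int]) simp
    then show "set_integrable lborel (einterval (-\<infinity>) 0) (\<lambda>x. q (exp x) * exp x)"
      unfolding set_integrable_def qp zero_ereal_def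
      by (simp add: indicator_def mult.commute cong: if_cong)
  qed (auto intro!: derivative_eq_intros)
  also have "\<dots> = (LBINT t=0..\<infinity>. p t)"
    unfolding qp by (subst interval_integral_reflect) simp
  also have "\<dots> = (LBINT t:{0<..}. p t)"
    by (subst interval_integral_Ioi) auto
  also have "(LBINT u=0..1. q u) = (LBINT u:{0<..<1}. q u)"
    by (subst interval_integral_Ioo) auto
  finally show ?thesis using first unfolding p_def q_def by simp
qed

end
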